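(* For real $\alpha>1/2$ let $\widetilde{w}_\alpha(\gamma)=\Gamma(\alpha-1/2+i\gamma)/\Gamma(\alpha)$ for $\gamma\in\mathbb{R}$. Then, as $\alpha\to\infty$, \[ \mathtt{D}[\widetilde{w}_\alpha]\ge\Big(\frac{\alpha}{2}-\frac14\Big)\Big\{1+O\Big(\frac{1}{\alpha^{3/7}}\Big)\Big\}. \]
   Context: For a nonzero $f\in L^2(\mathbb{R})$, its dispersion is \[ \mathtt{D}[f]=\int_{-\infty}^{+\infty}(x-\bar x)^2\frac{|f(x)|^2}{\|f\|_2^2}\,dx,\qquad \bar x=\int_{-\infty}^{+\infty}x\frac{|f(x)|^2}{\|f\|_2^2}\,dx. \] *)

theory Defs
  imports "HOL-Analysis.Analysis" "HOL-Library.Landau_Symbols"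
begin

definition L2_norm :: "(real \<Rightarrow> complex) \<Rightarrow> real" where
  "L2_norm f = sqrt (LINT x|lebesgue. (cmod (f x))\<^sup>2)"

definition mean_position :: "(real \<Rightarrow> complex) \<Rightarrow> real" where
  "mean_position f = (LINT x|lebesgue. x * ((cmod (f x))\<^sup>2 / (L2_norm f)\<^sup>2))"

text \<open>
  The integrals are Bochner integrals, which are 0 when the integrand is not integrable. Hence
  the dispersion is 0 (and not infinite) if the second moment diverges, or if \<open>f\<close> is zero or
  not square integrable; a positive lower bound on it excludes all of these cases.
\<close>

definition dispersion :: "(real \<Rightarrow> complex) \<Rightarrow> real" where
  "dispersion f =
     (LINT x|lebesgue. (x - mean_position f)\<^sup>2 * ((cmod (f x))\<^sup>2 / (L2_norm f)\<^sup>2))"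

definition w_tilde :: "real \<Rightarrow> real \<Rightarrow> complex" where
  "w_tilde \<alpha> \<gamma> =
     Gamma (complex_of_real (\<alpha> - 1/2) + \<i> * complex_of_real \<gamma>) / Gamma (complex_of_real \<alpha>)"

end

theory Submission
  imports Defs "HOL-Complex_Analysis.Complex_Analysis" "HOL-Probability.Sinc_Integral"
begin

text \<open>
  Put \<open>a = \<alpha> - 1/2\<close> and \<open>P(t) = |\<Gamma>(a + it)|^2\<close>. The dispersion turns out to be exactly
  \<open>a/2\<close>, so the error term can be taken to be zero. Indeed \<open>\<Gamma>(z) \<Gamma>(2a + 2 - z)\<close> is
  holomorphic and decays on the strip \<open>a \<le> Re z \<le> a + 1\<close>, hence it has the same integral over
  both boundary lines. By the functional equation it equals \<open>(a^2 + t^2) P(t)\<close> at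
  \<open>z = a + 1 + it\<close> and \<open>(a + 1 - it) (a - it) P(t)\<close> at \<open>z = a + it\<close>. Comparing real parts, the
  integral of \<open>(2t^2 - a) P(t)\<close> vanishes; the mean is zero because \<open>P\<close> is even.
\<close>

section \<open>Bounds for Gamma on the right half-plane\<close>

lemma norm_Gamma_le_Gamma_Re:
  assumes "Re z > 0"
  shows "norm (Gamma z) \<le> Gamma (Re z)"
proof -
  have c: "((\<lambda>t. of_real t powr (z - 1) / of_real (exp t)) has_integral Gamma z) {0..}"
    by (rule Gamma_integral_complex) fact
  have r: "((\<lambda>t. t powr (Re z - 1) / exp t) has_integral Gamma (Re z)) {0..}"
    by (rule Gamma_integral_real) fact
  have "norm (integral {0..} (\<lambda>t. of_real t powr (z - 1) / of_real (exp t)))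
      \<le> integral {0..} (\<lambda>t. t powr (Re z - 1) / exp t)"
    using c r
    by (intro integral_norm_bound_integral)
       (auto simp: norm_divide norm_powr_real_powr has_integral_integrable)
  thus ?thesis
    using c r by (simp add: integral_unique)
qed

lemma not_nonpos_Int_if_Re_pos: "Re z > 0 \<Longrightarrow> z \<notin> \<int>\<^sub>\<le>\<^sub>0"
  by (auto elim!: nonpos_Ints_cases)

lemma Gamma_Re_pos_plus2:
  assumes "Re z > 0"
  shows "Gamma (z + 2) = (z + 1) * z * Gamma z"
proof -
  have "z \<notin> \<int>\<^sub>\<le>\<^sub>0" "z + 1 \<notin> \<int>\<^sub>\<le>\<^sub>0"
    using assms by (auto intro!: not_nonpos_Int_if_Re_pos)
  thus ?thesis
    using Gamma_plus1[of z] Gamma_plus1[of "z + 1"]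
    by (simp add: add.assoc mult.assoc)
qed

text \<open>Two applications of the functional equation lead to \<open>Gamma (z + 2)\<close> and
  produce the factors \<open>z\<close> and \<open>z + 1\<close>, each of modulus at least |Im z|.
  The resulting quadratic decay, used for both factors of the contour integrand, makes the
  horizontal edges negligible.\<close>

lemma norm_Gamma_mult_Im_squared_le:
  assumes "Re z > 0"
  shows "norm (Gamma z) * (Im z)\<^sup>2 \<le> Gamma (Re z + 2)"
proof -
  have "norm (Gamma z) * (Im z)\<^sup>2 = norm (Gamma z) * (\<bar>Im z\<bar> * \<bar>Im z\<bar>)"
    by (simp add: power2_eq_square)
  also have "\<dots> \<le> norm (Gamma z) * (norm (z + 1) * norm z)"
    using abs_Im_le_cmod[of "z + 1"] abs_Im_le_cmod[of z]
    by (intro mult_left_mono mult_mono) auto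
  also have "\<dots> = norm (Gamma (z + 2))"
    using assms by (simp add: Gamma_Re_pos_plus2 norm_mult)
  also have "\<dots> \<le> Gamma (Re z + 2)"
    using norm_Gamma_le_Gamma_Re[of "z + 2"] assms by simp
  finally show ?thesis .
qed

section \<open>The density |Gamma(a + it)|^2 and its integrability\<close>

definition Gamma_density :: "real \<Rightarrow> real \<Rightarrow> real" where
  "Gamma_density a t = (cmod (Gamma (Complex a t)))\<^sup>2"

lemma Gamma_density_nonneg: "Gamma_density a t \<ge> 0"
  by (simp add: Gamma_density_def)

lemma Gamma_density_pos: "a > 0 \<Longrightarrow> Gamma_density a t > 0"
  using not_nonpos_Int_if_Re_pos[of "Complex a t"]
  by (simp add: Gamma_density_def Gamma_eq_zero_iff)

lemma Gamma_density_minus: "Gamma_density a (- t) = Gamma_density a t"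
proof -
  have "Complex a (- t) = cnj (Complex a t)"
    by (simp add: complex_eq_iff)
  thus ?thesis
    by (simp only: Gamma_density_def cnj_Gamma [symmetric] complex_mod_cnj)
qed

lemma continuous_on_Gamma_density:
  assumes "a > 0"
  shows "continuous_on A (Gamma_density a)"
proof -
  have "continuous_on A (\<lambda>t. Gamma (complex_of_real a + \<i> * complex_of_real t))"
    using assms
    by (intro continuous_intros continuous_on_compose2[OF continuous_on_Gamma[of "{z. Re z > 0}"]])
       (auto dest: not_nonpos_Int_if_Re_pos)
  thus ?thesis
    unfolding Gamma_density_def Complex_eq by (intro continuous_intros)
qed

lemma borel_measurable_Gamma_density [measurable]:
  "a > 0 \<Longrightarrow> Gamma_density a \<in> borel_measurable borel"
  by (intro borel_measurable_continuous_onI continuous_on_Gamma_density)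

lemma integrable_inverse_1_plus_square_lborel:
  "integrable lborel (\<lambda>x::real. inverse (1 + x\<^sup>2))"
  using integrable_inverse_1_plus_square by (simp add: set_integrable_def)

text \<open>The left-hand side is exactly |Gamma(a + 2 + it)|^2, since the two quadratic factors are
  |a + it|^2 and |a + 1 + it|^2. Quartic decay is enough for moments up to the second.\<close>

lemma Gamma_density_quartic_bound:
  assumes "a > 0"
  shows "(a\<^sup>2 + t\<^sup>2) * ((a + 1)\<^sup>2 + t\<^sup>2) * Gamma_density a t \<le> (Gamma (a + 2))\<^sup>2"
proof -
  have "(a\<^sup>2 + t\<^sup>2) * ((a + 1)\<^sup>2 + t\<^sup>2) * Gamma_density a t
      = (norm ((Complex a t + 1) * Complex a t * Gamma (Complex a t)))\<^sup>2"
    unfolding norm_mult power_mult_distrib Gamma_density_def by (simp add: cmod_power2)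
  also have "\<dots> = (norm (Gamma (Complex a t + 2)))\<^sup>2"
    using assms by (simp add: Gamma_Re_pos_plus2)
  also have "\<dots> \<le> (Gamma (a + 2))\<^sup>2"
    using norm_Gamma_le_Gamma_Re[of "Complex a t + 2"] assms by (intro power_mono) simp_all
  finally show ?thesis .
qed

lemma integrable_Gamma_density_moment:
  assumes "a > 0" "k \<le> 2"
  shows "integrable lborel (\<lambda>t. t ^ k * Gamma_density a t)"
proof -
  \<comment> \<open>The factor 1 + 1/a^2 lifts a^2 + t^2 above 1 + t^2, which supplies the
    integrable majorant. The other factor (a + 1)^2 + t^2 absorbs the power |t|^k.\<close>
  define K where "K = (1 + 1 / a\<^sup>2) * (Gamma (a + 2))\<^sup>2"
  have bound: "norm (t ^ k * Gamma_density a t) \<le> norm (K * inverse (1 + t\<^sup>2))" for t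
  proof -
    have K: "K \<ge> 0" by (simp add: K_def)
    have "\<bar>t\<bar> ^ k * (1 + t\<^sup>2) \<le> (1 + 1 / a\<^sup>2) * ((a\<^sup>2 + t\<^sup>2) * ((a + 1)\<^sup>2 + t\<^sup>2))"
    proof -
      have "\<bar>t\<bar> ^ k \<le> 1 + t\<^sup>2"
      proof (cases "\<bar>t\<bar> \<le> 1")
        case True
        hence "\<bar>t\<bar> ^ k \<le> 1" by (intro power_le_one) auto
        thus ?thesis by (smt (verit) zero_le_power2)
      next
        case False
        hence "\<bar>t\<bar> ^ k \<le> \<bar>t\<bar> ^ 2" using assms by (intro power_increasing) auto
        thus ?thesis by simp
      qed
      moreover have "1 + t\<^sup>2 \<le> (a + 1)\<^sup>2 + t\<^sup>2"
        using assms by simp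
      moreover have "1 + t\<^sup>2 \<le> (1 + 1 / a\<^sup>2) * (a\<^sup>2 + t\<^sup>2)"
        using assms by (simp add: field_simps)
      ultimately have "\<bar>t\<bar> ^ k * (1 + t\<^sup>2) \<le> ((1 + 1 / a\<^sup>2) * (a\<^sup>2 + t\<^sup>2)) * ((a + 1)\<^sup>2 + t\<^sup>2)"
        by (intro mult_mono) (auto intro: order_trans)
      thus ?thesis by (simp add: mult.assoc)
    qed
    hence "\<bar>t\<bar> ^ k * (1 + t\<^sup>2) * Gamma_density a t
        \<le> (1 + 1 / a\<^sup>2) * ((a\<^sup>2 + t\<^sup>2) * ((a + 1)\<^sup>2 + t\<^sup>2)) * Gamma_density a t"
      by (intro mult_right_mono Gamma_density_nonneg)
    also have "\<dots> = (1 + 1 / a\<^sup>2) * ((a\<^sup>2 + t\<^sup>2) * ((a + 1)\<^sup>2 + t\<^sup>2) * Gamma_density a t)"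
      by (simp add: mult.assoc)
    also have "\<dots> \<le> K"
      unfolding K_def using Gamma_density_quartic_bound[OF assms(1)]
      by (intro mult_left_mono) auto
    finally have le: "\<bar>t\<bar> ^ k * (1 + t\<^sup>2) * Gamma_density a t \<le> K" .
    have "1 + t\<^sup>2 > 0" by (simp add: add_pos_nonneg)
    with le K show ?thesis
      by (simp add: abs_mult power_abs Gamma_density_nonneg field_simps)
  qed
  show ?thesis
  proof (rule Bochner_Integration.integrable_bound)
    show "integrable lborel (\<lambda>t. K * inverse (1 + t\<^sup>2))"
      by (intro integrable_mult_right integrable_inverse_1_plus_square_lborel)
    show "(\<lambda>t. t ^ k * Gamma_density a t) \<in> borel_measurable lborel"
      using assms by simp
  qed (use bound in auto)
qed

section \<open>The contour shift\<close>

text \<open>This is Cauchy's theorem on the rectangle with a \<le> Re z \<le> a + 1 and |Im z| \<le>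
  T: the vertical edges give the integral, and the horizontal edges are of size T^(-4).\<close>

lemma truncated_moment_identity_bound:
  assumes "a > 0"
  obtains B where "\<And>T. T > 0 \<Longrightarrow>
    \<bar>integral {-T..T} (\<lambda>t. (2 * t\<^sup>2 - a) * Gamma_density a t)\<bar> \<le> B / T ^ 4"
proof -
  define f where "f = (\<lambda>z::complex. Gamma z * Gamma (of_real (2 * a + 2) - z))"
  \<comment> \<open>On \<open>S\<close> both Gamma arguments have positive real part, so no pole is
    met. Convexity yields a primitive \<open>F\<close>, which turns every edge integral into a
    difference of two values of \<open>F\<close>.\<close>
  define S where "S = {z. 0 < Re z} \<inter> {z. Re z < 2 * a + 2}"
  have "convex S" "open S"
    unfolding S_def
    by (auto intro!: convex_Int open_Int convex_halfspace_Re_gt convex_halfspace_Re_lt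
        open_halfspace_Re_gt open_halfspace_Re_lt)
  moreover have "f holomorphic_on S"
    unfolding f_def S_def
    by (intro holomorphic_intros) (auto intro!: not_nonpos_Int_if_Re_pos)
  ultimately obtain F where F: "\<And>z. z \<in> S \<Longrightarrow> (F has_field_derivative f z) (at z within S)"
    using holomorphic_convex_primitive' by metis

  \<comment> \<open>This product bounds |f(z)| (Im z)^4 for Re z = x. Compactness makes the bound
    uniform across the strip.\<close>
  have "compact ((\<lambda>x. Gamma (x + 2) * Gamma (2 * a + 4 - x)) ` {a..a+1})"
    using assms
    by (intro compact_continuous_image continuous_intros
        continuous_on_compose2[OF continuous_on_Gamma[of "{0<..}"]])
       (auto elim!: nonpos_Ints_cases)
  hence "\<exists>M. \<forall>x\<in>{a..a+1}. \<bar>Gamma (x + 2) * Gamma (2 * a + 4 - x)\<bar> \<le> M"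
    by (auto dest!: compact_imp_bounded simp: bounded_iff)
  then obtain M where M: "\<And>x. x \<in> {a..a+1} \<Longrightarrow> \<bar>Gamma (x + 2) * Gamma (2 * a + 4 - x)\<bar> \<le> M"
    by blast

  have horizontal: "norm (F (Complex (a + 1) t) - F (Complex a t)) \<le> M / t ^ 4"
    if "t \<noteq> 0" for t
  proof -
    have seg: "Re z \<in> {a..a+1} \<and> Im z = t"
      if z: "z \<in> closed_segment (Complex a t) (Complex (a + 1) t)" for z
    proof -
      from z obtain u where u: "0 \<le> u" "u \<le> 1"
        "z = (1 - u) *\<^sub>R Complex a t + u *\<^sub>R Complex (a + 1) t"
        by (auto simp: in_segment)
      have "Re z = a + u" "Im z = t"
        unfolding u(3) by (simp_all add: algebra_simps)
      thus ?thesis using u by simp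
    qed
    have "(f has_contour_integral F (Complex (a + 1) t) - F (Complex a t))
        (linepath (Complex a t) (Complex (a + 1) t))"
      using contour_integral_primitive[OF F, of "linepath (Complex a t) (Complex (a + 1) t)"]
        seg assms by (fastforce simp: S_def)
    moreover have "norm (f z) \<le> M / t ^ 4"
      if "z \<in> closed_segment (Complex a t) (Complex (a + 1) t)" for z
    proof -
      let ?w = "of_real (2 * a + 2) - z"
      have z: "Re z \<in> {a..a+1}" "Im z = t" using seg[OF that] by auto
      have "(norm (Gamma z) * (Im z)\<^sup>2) * (norm (Gamma ?w) * (Im ?w)\<^sup>2)
          \<le> Gamma (Re z + 2) * Gamma (Re ?w + 2)"
        using z assms
        by (intro mult_mono norm_Gamma_mult_Im_squared_le) (auto intro!: less_imp_le[OF Gamma_real_pos])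
      also have "\<dots> \<le> M"
        using M[OF z(1)] by (simp add: algebra_simps)
      finally have "norm (f z) * t ^ 4 \<le> M"
        using z by (simp add: f_def norm_mult eval_nat_numeral mult_ac)
      thus ?thesis using \<open>t \<noteq> 0\<close> by (simp add: field_simps)
    qed
    moreover have "0 \<le> M / t ^ 4"
      using M[of a] by simp
    ultimately have "norm (F (Complex (a + 1) t) - F (Complex a t))
        \<le> M / t ^ 4 * norm (Complex (a + 1) t - Complex a t)"
      by (intro has_contour_integral_bound_linepath)
    also have "Complex (a + 1) t - Complex a t = 1"
      by (simp add: complex_eq_iff)
    finally show ?thesis by simp
  qed

  \<comment> \<open>The factor -i arises from dz = i dt on a vertical line.\<close>
  have vertical: "((\<lambda>t. f (Complex c t)) has_integral
      (- \<i> * (F (Complex c T) - F (Complex c (- T))))) {-T..T}"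
    if "c \<in> {a..a+1}" "T > 0" for c T
  proof -
    have "path_image (linepath (Complex c (- T)) (Complex c T)) \<subseteq> S"
      unfolding path_image_linepath using that assms
      by (intro closed_segment_subset \<open>convex S\<close>) (auto simp: S_def)
    hence "(f has_contour_integral F (Complex c T) - F (Complex c (- T)))
        (linepath (Complex c (- T)) (Complex c T))"
      using contour_integral_primitive[OF F, of "linepath (Complex c (- T)) (Complex c T)"] by simp
    thus ?thesis
      using that
      by (subst (asm) has_contour_integral_linepath_same_Re_iff[where c = c and a = "-T" and b = T])
         auto
  qed

  \<comment> \<open>The reflection of z to 2a + 2 - z acts as conjugation on Re z = a + 1. The
    polynomial is (a^2 + t^2) - Re ((a + 1 - it)(a - it)), where the real part is a^2 + a -
    t^2.\<close>
  have f_diff: "Re (f (Complex (a + 1) t) - f (Complex a t)) = (2 * t\<^sup>2 - a) * Gamma_density a t" for t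
  proof -
    let ?z = "Complex a t"
    have G: "Gamma ?z * Gamma (cnj ?z) = of_real (Gamma_density a t)"
      by (simp only: Gamma_density_def cnj_Gamma [symmetric] complex_norm_square)
    have z: "?z \<notin> \<int>\<^sub>\<le>\<^sub>0" "cnj ?z \<notin> \<int>\<^sub>\<le>\<^sub>0"
      using assms by (auto intro!: not_nonpos_Int_if_Re_pos)
    have e: "Complex (a + 1) t = ?z + 1" "of_real (2 * a + 2) - Complex (a + 1) t = cnj ?z + 1"
      "of_real (2 * a + 2) - ?z = cnj ?z + 2"
      by (simp_all add: complex_eq_iff)
    have "f (Complex (a + 1) t) = ?z * cnj ?z * (Gamma ?z * Gamma (cnj ?z))"
      unfolding f_def e(2) unfolding e(1) by (simp only: z[THEN Gamma_plus1] mult_ac)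
    moreover have "f ?z = (cnj ?z + 1) * cnj ?z * (Gamma ?z * Gamma (cnj ?z))"
      unfolding f_def e(3) using assms by (subst Gamma_Re_pos_plus2) (simp_all only: mult_ac, simp)
    ultimately show ?thesis
      unfolding G by (simp add: power2_eq_square algebra_simps)
  qed

  show thesis
  proof (rule that[of "2 * M"])
    fix T :: real assume T: "T > 0"
    \<comment> \<open>\<open>?R\<close> and \<open>?L\<close> are the integrals of \<open>f\<close>
      over the top and bottom edges, both from left to right. Each has modulus at most M / T^4,
      whence the constant \<open>2 * M\<close>.\<close>
    let ?R = "F (Complex (a + 1) T) - F (Complex a T)"
    let ?L = "F (Complex (a + 1) (- T)) - F (Complex a (- T))"
    have "((\<lambda>t. f (Complex (a + 1) t) - f (Complex a t)) has_integral (- \<i> * (?R - ?L))) {-T..T}"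
      using has_integral_diff[OF vertical[of "a + 1" T] vertical[of a T]] T assms
      by (simp add: algebra_simps)
    from has_integral_linear[OF this bounded_linear_Re]
    have "((\<lambda>t. (2 * t\<^sup>2 - a) * Gamma_density a t) has_integral Re (- \<i> * (?R - ?L))) {-T..T}"
      unfolding o_def f_diff .
    hence "\<bar>integral {-T..T} (\<lambda>t. (2 * t\<^sup>2 - a) * Gamma_density a t)\<bar> = \<bar>Re (- \<i> * (?R - ?L))\<bar>"
      by (simp only: integral_unique)
    also have "\<dots> \<le> norm (?R - ?L)"
      using abs_Re_le_cmod[of "- \<i> * (?R - ?L)"]
      by (simp only: norm_mult norm_minus_cancel norm_ii mult_1_left)
    also have "\<dots> \<le> norm ?R + norm ?L"
      by (rule norm_triangle_ineq4)
    also have "\<dots> \<le> 2 * M / T ^ 4"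
      using horizontal[of T] horizontal[of "- T"] T by simp
    finally show "\<bar>integral {-T..T} (\<lambda>t. (2 * t\<^sup>2 - a) * Gamma_density a t)\<bar> \<le> 2 * M / T ^ 4" .
  qed
qed

section \<open>Moments of the density\<close>

lemma Gamma_density_second_moment:
  assumes "a > 0"
  shows "2 * (\<integral>t. t\<^sup>2 * Gamma_density a t \<partial>lborel) = a * (\<integral>t. Gamma_density a t \<partial>lborel)"
proof -
  let ?g = "\<lambda>t. (2 * t\<^sup>2 - a) * Gamma_density a t"
  note int0 = integrable_Gamma_density_moment[OF assms, of 0, simplified]
  note int2 = integrable_Gamma_density_moment[OF assms, of 2, simplified]
  have g_eq: "?g = (\<lambda>t. 2 * (t\<^sup>2 * Gamma_density a t) - a * Gamma_density a t)"
    by (simp add: fun_eq_iff algebra_simps)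
  have int: "integrable lborel ?g"
    unfolding g_eq by (intro Bochner_Integration.integrable_diff integrable_mult_right int0 int2)
  obtain B where B: "\<And>T. T > 0 \<Longrightarrow> \<bar>integral {-T..T} ?g\<bar> \<le> B / T ^ 4"
    using truncated_moment_identity_bound[OF assms] by blast
  \<comment> \<open>The integrals truncated at T = n tend to the full integral by dominated
    convergence and to 0 by the contour bound, so the full integral vanishes.\<close>
  have lim: "(\<lambda>n. \<integral>t. indicator {-real n..real n} t *\<^sub>R ?g t \<partial>lborel) \<longlonglongrightarrow> (\<integral>t. ?g t \<partial>lborel)"
  proof (rule integral_dominated_convergence[where w = "\<lambda>t. norm (?g t)"])
    show "AE t in lborel. (\<lambda>n. indicator {-real n..real n} t *\<^sub>R ?g t) \<longlonglongrightarrow> ?g t"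
    proof (rule AE_I2)
      fix t :: real
      obtain N where N: "\<bar>t\<bar> \<le> real N" using real_arch_simple by blast
      have "\<forall>\<^sub>F n in sequentially. indicator {-real n..real n} t *\<^sub>R ?g t = ?g t"
        using eventually_ge_at_top[of N] by eventually_elim (use N in \<open>auto simp: indicator_def\<close>)
      thus "(\<lambda>n. indicator {-real n..real n} t *\<^sub>R ?g t) \<longlonglongrightarrow> ?g t"
        by (rule tendsto_eventually)
    qed
    show "AE t in lborel. norm (indicator {-real n..real n} t *\<^sub>R ?g t) \<le> norm (?g t)" for n
      by (auto simp: indicator_def)
  qed (use int assms in auto)
  have "(\<lambda>n. \<integral>t. indicator {-real n..real n} t *\<^sub>R ?g t \<partial>lborel) \<longlonglongrightarrow> 0"
  proof (rule tendsto_0_le[where K = 1])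
    show "(\<lambda>n. B / real n ^ 4) \<longlonglongrightarrow> 0" by real_asymp
    show "\<forall>\<^sub>F n in sequentially. norm (\<integral>t. indicator {-real n..real n} t *\<^sub>R ?g t \<partial>lborel)
        \<le> norm (B / real n ^ 4) * 1"
      using eventually_gt_at_top[of 0]
    proof eventually_elim
      case (elim n)
      have "set_integrable lborel {-real n..real n} ?g"
        unfolding set_integrable_def using int by (rule integrable_mult_indicator[rotated]) simp
      hence "(\<integral>t. indicator {-real n..real n} t *\<^sub>R ?g t \<partial>lborel) = integral {-real n..real n} ?g"
        using set_borel_integral_eq_integral(2) unfolding set_lebesgue_integral_def by blast
      thus ?case using order_trans[OF B[of "real n"] abs_ge_self] elim by simp
    qed
  qed
  hence "(\<integral>t. ?g t \<partial>lborel) = 0"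
    using lim LIMSEQ_unique by blast
  thus ?thesis
    unfolding g_eq using int0 int2 by simp
qed

lemma Gamma_density_first_moment:
  "(\<integral>t. t * Gamma_density a t \<partial>lborel) = 0"
proof -
  have "(\<integral>t. t * Gamma_density a t \<partial>lborel) = (\<integral>t. - (t * Gamma_density a t) \<partial>lborel)"
    using lborel_integral_real_affine[of "-1" "\<lambda>t. t * Gamma_density a t" 0]
    by (simp add: Gamma_density_minus)
  thus ?thesis by simp
qed

text \<open>A nonnegative function with integral zero vanishes almost everywhere, but this density
  is positive everywhere because Gamma has no zeros. Division by the squared norm is thereby
  legitimate.\<close>

lemma Gamma_density_integral_pos:
  assumes "a > 0"
  shows "(\<integral>t. Gamma_density a t \<partial>lborel) > 0"
proof -
  note int = integrable_Gamma_density_moment[OF assms, of 0, simplified]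
  have "(\<integral>t. Gamma_density a t \<partial>lborel) \<noteq> 0"
  proof
    assume "(\<integral>t. Gamma_density a t \<partial>lborel) = 0"
    hence "AE t in lborel. Gamma_density a t = 0"
      using int by (subst (asm) integral_nonneg_eq_0_iff_AE) (auto simp: Gamma_density_nonneg)
    hence "AE t::real in lborel. False"
      by eventually_elim (use Gamma_density_pos[OF assms] in \<open>metis less_irrefl\<close>)
    thus False
      by (simp add: eventually_False ae_filter_eq_bot_iff)
  qed
  thus ?thesis
    by (simp add: order_less_le Gamma_density_nonneg)
qed

section \<open>The exact dispersion\<close>

lemma dispersion_w_tilde:
  assumes "\<alpha> > 1/2"
  shows "dispersion (w_tilde \<alpha>) = \<alpha>/2 - 1/4"
proof -
  define a where "a = \<alpha> - 1/2"
  define I where "I = (\<integral>t. Gamma_density a t \<partial>lborel)"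
  define c where "c = (Gamma \<alpha>)\<^sup>2"
  have a: "a > 0" and c: "c > 0"
    using assms Gamma_real_pos[of \<alpha>] by (simp_all add: a_def c_def del: Gamma_real_pos)
  have I: "I > 0"
    unfolding I_def by (rule Gamma_density_integral_pos) fact
  have meas [measurable]: "Gamma_density a \<in> borel_measurable borel"
    using a by simp
  have w: "(cmod (w_tilde \<alpha> t))\<^sup>2 = Gamma_density a t / c" for t
    using assms
    by (simp add: w_tilde_def Gamma_density_def a_def c_def Complex_eq norm_divide power_divide
        Gamma_complex_of_real)
  \<comment> \<open>Lebesgue measure is the completion of \<open>lborel\<close>, so the integrals of
    these Borel functions agree.\<close>
  have "(LINT x|lebesgue. (cmod (w_tilde \<alpha> x))\<^sup>2) = I / c"
    unfolding w I_def by (subst integral_completion) auto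
  hence norm: "(L2_norm (w_tilde \<alpha>))\<^sup>2 = I / c"
    using I c by (simp add: L2_norm_def)
  \<comment> \<open>The normalising constant Gamma(\<alpha>)^2 cancels, which reduces the dispersion
    to the ratio of the second moment to the total mass.\<close>
  have quot: "(cmod (w_tilde \<alpha> t))\<^sup>2 / (L2_norm (w_tilde \<alpha>))\<^sup>2 = Gamma_density a t / I" for t
    unfolding w norm using c by simp
  have mean: "mean_position (w_tilde \<alpha>) = 0"
    unfolding mean_position_def quot
    using Gamma_density_first_moment[of a] by (subst integral_completion) auto
  have "dispersion (w_tilde \<alpha>) = (\<integral>t. t\<^sup>2 * Gamma_density a t \<partial>lborel) / I"
    unfolding dispersion_def quot mean by (subst integral_completion) auto
  also have "\<dots> = a / 2"
    using Gamma_density_second_moment[OF a] I unfolding I_def by (simp add: field_simps)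
  finally show ?thesis
    by (simp add: a_def field_simps)
qed

theorem theorem3:
  "\<exists>E :: real \<Rightarrow> real.
     E \<in> O[at_top](\<lambda>\<alpha>. 1 / \<alpha> powr (3/7)) \<and>
     (\<forall>\<^sub>F \<alpha> in at_top. dispersion (w_tilde \<alpha>) \<ge> (\<alpha>/2 - 1/4) * (1 + E \<alpha>))"
proof (intro exI conjI)
  \<comment> \<open>Equality holds for all \<alpha> > 1/2, so the zero function serves as the
    witness for \<open>E\<close>.\<close>
  show "(\<lambda>_. 0) \<in> O[at_top](\<lambda>\<alpha>::real. 1 / \<alpha> powr (3/7))"
    by simp
  show "\<forall>\<^sub>F \<alpha> in at_top. dispersion (w_tilde \<alpha>) \<ge> (\<alpha>/2 - 1/4) * (1 + 0)"
    using eventually_gt_at_top[of "1/2"] by eventually_elim (simp add: dispersion_w_tilde)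
qed

end
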